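(* Let $x\in\mathbb{Q}$ and let $U$ be the stabilized unknot, i.e. the framed unknot represented (with blackboard framing) by the figure-eight-shaped diagram with exactly one crossing, which is negative. Then $$[U]_x=\{x\}.$$
   Context: **$q$-rationals.** For $n\in\mathbb{Z}$, $\{n\}=\frac{q^{2n}-1}{q^2-1}$, and $\{n\}_-:=\frac{q^{-2n}-1}{q^{-2}-1}$. For $x\in\mathbb{Q}$ let $x=[a_1,\dots,a_n]$ be its continued fraction expansion $a_1+\cfrac{1}{a_2+\cdots}$ of even length $n$ ($a_1\in\mathbb{Z}$, $a_i\ge1$ for $i\ge2$). Then $$\{x\}=\{a_1\}+\cfrac{q^{2a_1}}{\{a_2\}_-+\cfrac{q^{-2a_2}}{\{a_3\}+\cfrac{q^{2a_3}}{\ddots+\cfrac{q^{2a_{n-1}}}{\{a_n\}_-}}}}\in\mathbb{Q}(q).$$ Put $\delta_x=\{x\}-\{x-1\}$ and let $\nu_x$ be a square root: $\nu_x^2=\delta_x^{-1}$ (with $\nu_n=q^{1-n}$ for integral $x=n$). **Framed HOMFLY-PT polynomial.** For a framed oriented link diagram $D$ (blackboard framing), $[D]_a\in\mathbb{Z}[q^{\pm1},a^{\pm1}][(q-q^{-1})^{-1}]$ is the framed link invariant determined by: the empty diagram has value $1$; a disjoint crossingless circle contributes the factor $\mu=\frac{a-a^{-1}}{q-q^{-1}}$; $q^{-1}[D_+]_a-q[D_-]_a=(q^{-1}-q)[D_0]_a$ where $D_+,D_-,D_0$ differ only at one place by a positive crossing, a negative crossing, and the oriented smoothing; removing a negative curl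 contributes the factor $q^{-1}a$, and removing a positive curl contributes $qa^{-1}$. (A crossing is positive if, with both strands directed upward, the over strand goes from bottom left to top right.) $[D]_x$ is the specialization of $[D]_a$ at $a=q\nu_x\delta_x$. *)

theory Defs
  imports "HOL-Algebra.Algebraic_Closure_Type"
begin

section \<open>The $q$-rationals\<close>

text \<open>The field of rational functions in $q$ is realised as the fraction field of the integer
  polynomials in $q$.\<close>

type_synonym qfield = "int poly fract"

definition emb :: "'a::idom \<Rightarrow> 'a fract" where
  "emb p = Fract p 1"

definition q :: qfield where
  "q = emb [:0, 1:]"

definition qint :: "int \<Rightarrow> qfield" where
  "qint n = (q powi (2 * n) - 1) / (q ^ 2 - 1)"

definition qint_neg :: "int \<Rightarrow> qfield" where
  "qint_neg n = (q powi (- 2 * n) - 1) / (q powi (- 2) - 1)"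

fun cf_value :: "int list \<Rightarrow> rat" where
  "cf_value [] = 0"
| "cf_value [a] = of_int a"
| "cf_value (a # b # as) = of_int a + 1 / cf_value (b # as)"

definition is_even_cf :: "rat \<Rightarrow> int list \<Rightarrow> bool" where
  "is_even_cf x as \<longleftrightarrow>
     as \<noteq> [] \<and> even (length as) \<and> (\<forall>a\<in>set (tl as). a \<ge> 1) \<and> cf_value as = x"

fun qcf :: "int list \<Rightarrow> qfield" and qcf_neg :: "int list \<Rightarrow> qfield" where
  "qcf [] = 0"
| "qcf [a] = qint a"
| "qcf (a # b # as) = qint a + q powi (2 * a) / qcf_neg (b # as)"
| "qcf_neg [] = 0"
| "qcf_neg [a] = qint_neg a"
| "qcf_neg (a # b # as) = qint_neg a + q powi (- 2 * a) / qcf (b # as)"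

text \<open>Every rational number has exactly one expansion of even length; see \<open>ex1_even_cf\<close>
  below.\<close>

definition qrat :: "rat \<Rightarrow> qfield" where
  "qrat x = qcf (THE as. is_even_cf x as)"

definition qdelta :: "rat \<Rightarrow> qfield" where
  "qdelta x = qrat x - qrat (x - 1)"

text \<open>The square roots $\nu_x$ live in an algebraic closure of the field of rational functions
  in $q$.\<close>

definition is_qnu :: "rat \<Rightarrow> qfield alg_closure \<Rightarrow> bool" where
  "is_qnu x \<nu> \<longleftrightarrow>
     \<nu> ^ 2 = inverse (to_ac (qdelta x)) \<and>
     (\<forall>n::int. x = of_int n \<longrightarrow> \<nu> = to_ac q powi (1 - n))"


section \<open>Oriented link diagrams\<close>

text \<open>An oriented link diagram in the plane, in general position with respect to the height
  function, is read from bottom to top as a list of slices. Each slice is an elementary piece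
  together with the number of vertical strands to the left of it. A horizontal level is described
  by the list of directions of its strands, read from left to right, where \<^term>\<open>True\<close> means
  upward. \<open>Cup d\<close> is a local minimum whose left leg has direction \<open>d\<close>, \<open>Cap\<close> is a local
  maximum, and \<open>Cross b\<close> is a crossing at which the strand running from bottom left to top right
  (or backwards along this line) is the over strand if and only if \<open>b\<close> holds. The framing is the
  blackboard framing.\<close>

datatype piece = Cup bool | Cap | Cross bool

type_synonym slice = "nat \<times> piece"

fun in_strands :: "piece \<Rightarrow> nat" where
  "in_strands (Cup d) = 0"
| "in_strands Cap = 2"
| "in_strands (Cross b) = 2"

fun out_strands :: "piece \<Rightarrow> nat" where
  "out_strands (Cup d) = 2"
| "out_strands Cap = 0"
| "out_strands (Cross b) = 2"

inductive slice :: "bool list \<Rightarrow> slice \<Rightarrow> bool list \<Rightarrow> bool" where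
  cup: "slice (l @ r) (length l, Cup d) (l @ d # (\<not> d) # r)"
| cap: "slice (l @ d # (\<not> d) # r) (length l, Cap) (l @ r)"
| cross: "slice (l @ d # e # r) (length l, Cross b) (l @ e # d # r)"

inductive tangle :: "bool list \<Rightarrow> slice list \<Rightarrow> bool list \<Rightarrow> bool" where
  Nil: "tangle s [] s"
| Cons: "slice s p t \<Longrightarrow> tangle t D u \<Longrightarrow> tangle s (p # D) u"

definition link_diagram :: "slice list \<Rightarrow> bool" where
  "link_diagram D \<longleftrightarrow> tangle [] D []"

text \<open>The elementary moves which generate isotopy of framed oriented links. The rules \<open>far\<close> to
  \<open>cup_slide\<close> are the planar isotopies: exchanging the heights of distant pieces, straightening a
  strand, and turning a crossing past an extremum (seen from the other side of the extremum, the
  same crossing has the other value of \<open>b\<close>). The rules \<open>R2\<close> and \<open>R3\<close> are Reidemeister moves, with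
  all orientations of the strands. Instead of the first Reidemeister move, which changes the
  blackboard framing, there is only \<open>framed_R1\<close>: curls of the same sign on either side of a strand
  represent the same framing twist. The cups on both sides of a rule carry the orientations which
  are forced by equal orientations of the boundary.\<close>

inductive elem_move :: "slice list \<Rightarrow> slice list \<Rightarrow> bool" where
  far: "elem_move [(i, p), (i + out_strands p + m, r)] [(i + in_strands p + m, r), (i, p)]"
| zigzag_right: "elem_move [(i + 1, Cup d), (i, Cap)] []"
| zigzag_left: "elem_move [(i, Cup d), (i + 1, Cap)] []"
| cap_slide: "elem_move [(i, Cross b), (i + 1, Cap)] [(i + 1, Cross (\<not> b)), (i, Cap)]"
| cup_slide: "elem_move [(i + 1, Cup d), (i, Cross b)] [(i, Cup d), (i + 1, Cross (\<not> b))]"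
| R2: "elem_move [(i, Cross b), (i, Cross (\<not> b))] []"
| R3: "elem_move [(i, Cross b), (i + 1, Cross b), (i, Cross b)]
                 [(i + 1, Cross b), (i, Cross b), (i + 1, Cross b)]"
| framed_R1: "elem_move [(i + 1, Cup d), (i, Cross b), (i + 1, Cap)]
                        [(i, Cup (\<not> d)), (i + 1, Cross b), (i, Cap)]"

inductive diagram_move :: "slice list \<Rightarrow> slice list \<Rightarrow> bool" where
  "elem_move L R \<Longrightarrow> link_diagram (A @ L @ B) \<Longrightarrow> link_diagram (A @ R @ B) \<Longrightarrow>
     diagram_move (A @ L @ B) (A @ R @ B)"

definition framed_isotopic :: "slice list \<Rightarrow> slice list \<Rightarrow> bool" where
  "framed_isotopic = equivclp diagram_move"


section \<open>The framed HOMFLY-PT polynomial\<close>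

text \<open>The ring of coefficients is a subring of the fraction field of the polynomials in $a$ over
  the integer polynomials in $q$ (the inner variable is $q$, the outer one is $a$).\<close>

type_synonym qafield = "int poly poly fract"

definition vq :: qafield where
  "vq = emb [:[:0, 1:]:]"

definition va :: qafield where
  "va = emb [:0, 1:]"

definition homfly_ring :: "qafield set" where
  "homfly_ring = {emb p / (vq ^ i * va ^ j * (vq - inverse vq) ^ k) | p i j k. True}"

definition mu :: qafield where
  "mu = (va - inverse va) / (vq - inverse vq)"

text \<open>In \<open>skein\<close> both strands at the crossing are directed upward, so that \<open>Cross True\<close> is
  positive and \<open>Cross False\<close> is negative. In a curl the two strands at the crossing are both
  directed upward or both directed downward, so that again the crossing is positive if and only
  if it is \<open>Cross True\<close>.\<close>

definition is_framed_homfly :: "(slice list \<Rightarrow> qafield) \<Rightarrow> bool" where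
  "is_framed_homfly P \<longleftrightarrow>
     \<comment> \<open>framed link invariant with values in the ring of coefficients\<close>
     (\<forall>D. link_diagram D \<longrightarrow> P D \<in> homfly_ring) \<and>
     (\<forall>D E. link_diagram D \<longrightarrow> link_diagram E \<longrightarrow> framed_isotopic D E \<longrightarrow> P D = P E) \<and>
     \<comment> \<open>empty diagram\<close>
     P [] = 1 \<and>
     \<comment> \<open>disjoint crossingless circle\<close>
     (\<forall>A B i d. link_diagram (A @ B) \<longrightarrow> link_diagram (A @ [(i, Cup d), (i, Cap)] @ B) \<longrightarrow>
        P (A @ [(i, Cup d), (i, Cap)] @ B) = mu * P (A @ B)) \<and>
     \<comment> \<open>skein relation\<close>
     (\<forall>A B l r. tangle [] A (l @ True # True # r) \<longrightarrow> tangle (l @ True # True # r) B [] \<longrightarrow>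
        inverse vq * P (A @ [(length l, Cross True)] @ B)
          - vq * P (A @ [(length l, Cross False)] @ B)
        = (inverse vq - vq) * P (A @ B)) \<and>
     \<comment> \<open>removing a curl, which lies on the right or on the left of the strand\<close>
     (\<forall>A B C i d b.
        C \<in> {[(i + 1, Cup d), (i, Cross b), (i + 1, Cap)],
             [(i, Cup d), (i + 1, Cross b), (i, Cap)]} \<longrightarrow>
        link_diagram (A @ B) \<longrightarrow> link_diagram (A @ C @ B) \<longrightarrow>
        P (A @ C @ B) = (if b then vq * inverse va else inverse vq * va) * P (A @ B))"

text \<open>The value of a rational function in $q$ and $a$ at $a = \alpha$; it is computed with any
  fraction whose denominator does not vanish at $\alpha$, see \<open>specialize_eq\<close> below. Elements of
  \<^const>\<open>homfly_ring\<close> have such a fraction whenever $\alpha \neq 0$.\<close>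

definition eval_a :: "qfield alg_closure \<Rightarrow> int poly poly \<Rightarrow> qfield alg_closure" where
  "eval_a \<alpha> p = poly (map_poly (\<lambda>c. to_ac (emb c)) p) \<alpha>"

definition specialize :: "qfield alg_closure \<Rightarrow> qafield \<Rightarrow> qfield alg_closure" where
  "specialize \<alpha> f =
     (THE y. \<exists>p d. f = emb p / emb d \<and> eval_a \<alpha> d \<noteq> 0 \<and> y = eval_a \<alpha> p / eval_a \<alpha> d)"

text \<open>For \<open>P\<close> the framed HOMFLY-PT polynomial and \<open>\<nu>\<close> the square root $\nu_x$, this is
  $[D]_x$.\<close>

definition homfly_at ::
  "(slice list \<Rightarrow> qafield) \<Rightarrow> rat \<Rightarrow> qfield alg_closure \<Rightarrow> slice list \<Rightarrow> qfield alg_closure" where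
  "homfly_at P x \<nu> D = specialize (to_ac q * \<nu> * to_ac (qdelta x)) (P D)"

text \<open>The figure-eight-shaped diagram: two lobes side by side, whose inner legs cross. Both strands
  at the crossing are directed upward, so that the crossing is negative.\<close>

definition stabilized_unknot :: "slice list" where
  "stabilized_unknot =
     [(0, Cup False), (2, Cup True), (1, Cross False), (2, Cap), (0, Cap)]"


section \<open>Well-definedness\<close>

lemma link_diagram_stabilized_unknot: "link_diagram stabilized_unknot"
proof -
  have "slice [] (0, Cup False) [False, True]"
    using slice.cup[of "[]" "[]" False] by simp
  moreover have "slice [False, True] (2, Cup True) [False, True, True, False]"
    using slice.cup[of "[False, True]" "[]" True] by (simp add: numeral_2_eq_2)
  moreover have "slice [False, True, True, False] (1, Cross False) [False, True, True, False]"
    using slice.cross[of "[False]" True True "[False]" False] by simp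
  moreover have "slice [False, True, True, False] (2, Cap) [False, True]"
    using slice.cap[of "[False, True]" True "[]"] by (simp add: numeral_2_eq_2)
  moreover have "slice [False, True] (0, Cap) []"
    using slice.cap[of "[]" False "[]"] by simp
  ultimately show ?thesis
    unfolding link_diagram_def stabilized_unknot_def by (blast intro: tangle.intros)
qed

lemma cf_value_Cons: "as \<noteq> [] \<Longrightarrow> cf_value (a # as) = of_int a + 1 / cf_value as"
  by (cases as) auto

lemma cf_value_ge_1: "as \<noteq> [] \<Longrightarrow> \<forall>a\<in>set as. a \<ge> 1 \<Longrightarrow> cf_value as \<ge> 1"
proof (induction as)
  case (Cons a as)
  show ?case
  proof (cases "as = []")
    case False
    then have "cf_value as \<ge> 1" using Cons by simp
    moreover have "(of_int a :: rat) \<ge> 1" using Cons.prems by simp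
    ultimately show ?thesis using False
      by (simp add: cf_value_Cons add_increasing2)
  qed (use Cons.prems in simp)
qed simp

lemma cf_value_eq_1: "as \<noteq> [] \<Longrightarrow> \<forall>a\<in>set as. a \<ge> 1 \<Longrightarrow> cf_value as = 1 \<Longrightarrow> as = [1]"
proof (cases as)
  case (Cons a bs)
  assume as: "\<forall>a\<in>set as. a \<ge> 1" "cf_value as = 1"
  show ?thesis
  proof (cases "bs = []")
    case False
    have "cf_value bs \<ge> 1" using cf_value_ge_1[OF False] as Cons by simp
    then have "1 / cf_value bs > 0" by simp
    moreover have "(of_int a :: rat) \<ge> 1" using as Cons by simp
    moreover have "cf_value as = of_int a + 1 / cf_value bs"
      using Cons False by (simp add: cf_value_Cons)
    ultimately show ?thesis using as(2) by linarith
  qed (use as Cons in simp)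
qed simp

lemma cf_unique:
  assumes "length as mod 2 = length bs mod 2" "as \<noteq> []" "bs \<noteq> []"
    and "\<forall>a\<in>set (tl as). a \<ge> 1" "\<forall>a\<in>set (tl bs). a \<ge> 1" "cf_value as = cf_value bs"
  shows "as = bs"
  using assms
proof (induction as arbitrary: bs)
  case (Cons a as)
  from Cons.prems obtain b bs' where bs: "bs = b # bs'" by (cases bs) auto
  have step: "(cs = [1] \<and> c + 1 = \<lfloor>cf_value (c # cs)\<rfloor>) \<or>
      (cs \<noteq> [1] \<and> c = \<lfloor>cf_value (c # cs)\<rfloor>)" if "\<forall>a\<in>set cs. a \<ge> 1" for c cs
  proof (cases "cs = [] \<or> cs = [1]")
    case False
    then have "cf_value cs > 1"
      using cf_value_ge_1[of cs] cf_value_eq_1[of cs] that by fastforce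
    then have "0 < 1 / cf_value cs" "1 / cf_value cs < 1" by simp_all
    then have "\<lfloor>of_int c + 1 / cf_value cs\<rfloor> = c" by (simp add: floor_eq_iff)
    then show ?thesis using False by (simp add: cf_value_Cons)
  qed auto
  have sa: "\<forall>a\<in>set as. a \<ge> 1" and sb: "\<forall>a\<in>set bs'. a \<ge> 1" using Cons.prems bs by auto
  have fl: "\<lfloor>cf_value (a # as)\<rfloor> = \<lfloor>cf_value (b # bs')\<rfloor>" using Cons.prems bs by simp
  have int_nil: "cs = []" if "\<forall>a\<in>set cs. a \<ge> 1" "cf_value (c # cs) = of_int m" "cs \<noteq> [1]"
    for c cs m
  proof (rule ccontr)
    assume "cs \<noteq> []"
    then have "cf_value cs > 1"
      using cf_value_ge_1[of cs] cf_value_eq_1[of cs] that by fastforce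
    then have "0 < 1 / cf_value cs" "1 / cf_value cs < 1" by simp_all
    moreover have "1 / cf_value cs = of_int (m - c)" using that \<open>cs \<noteq> []\<close> by (simp add: cf_value_Cons)
    ultimately have "0 < m - c" "m - c < 1" by (metis of_int_0_less_iff, metis of_int_less_1_iff)
    then show False by simp
  qed
  have par: "length as mod 2 = length bs' mod 2" using Cons.prems(1) bs by simp presburger
  have one: "as = [1] \<longleftrightarrow> bs' = [1]"
  proof (rule ccontr)
    assume "\<not> ?thesis"
    then consider "as = [1]" "bs' \<noteq> [1]" | "bs' = [1]" "as \<noteq> [1]" by blast
    then show False
    proof cases
      case 1
      then have "cf_value (b # bs') = of_int (a + 1)" using Cons.prems(6) bs by simp
      from int_nil[OF sb this 1(2)] 1 par show False by simp
    next
      case 2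
      then have "cf_value (a # as) = of_int (b + 1)" using Cons.prems(6) bs by simp
      from int_nil[OF sa this 2(2)] 2 par show False by simp
    qed
  qed
  have ab: "a = b" using step[OF sa, of a] step[OF sb, of b] fl one by linarith
  show ?case
  proof (cases "as = [] \<or> bs' = []")
    case True
    have "cf_value cs = 0 \<longleftrightarrow> cs = []" if "\<forall>a\<in>set cs. a \<ge> 1" for cs
      using cf_value_ge_1[of cs] that by fastforce
    moreover have "1 / cf_value as = 1 / cf_value bs'"
      using Cons.prems(6) bs ab by (cases as; cases bs') auto
    ultimately show ?thesis using True sa sb ab bs by auto
  next
    case False
    then have "cf_value as = cf_value bs'" using Cons.prems(6) bs ab by (simp add: cf_value_Cons)
    moreover have "\<forall>a\<in>set (tl as). a \<ge> 1" "\<forall>a\<in>set (tl bs'). a \<ge> 1"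
      using sa sb False by (auto dest: list.set_sel(2))
    ultimately show ?thesis using Cons.IH[of bs'] par False ab bs by simp
  qed
qed simp

lemma cf_exists:
  assumes "d > 0"
  shows "\<exists>as. as \<noteq> [] \<and> length as mod 2 = k mod 2 \<and> (\<forall>a\<in>set (tl as). a \<ge> 1) \<and>
           cf_value as = of_int n / of_int (int d)"
  using assms
proof (induction d arbitrary: n k rule: less_induct)
  case (less d)
  define m r where "m = n div int d" and "r = nat (n mod int d)"
  have r: "int r = n mod int d" "r < d" using less.prems by (auto simp: r_def nat_less_iff)
  have n: "n = m * int d + int r"
    unfolding r(1) m_def by (rule div_mult_mod_eq[symmetric])
  have nd: "(of_int n / of_int (int d) :: rat) = of_int m + of_nat r / of_nat d"
    unfolding n using less.prems by (simp add: add_divide_distrib)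
  show ?case
  proof (cases "r = 0")
    case True
    show ?thesis
    proof (cases "odd k")
      case True
      then show ?thesis using nd \<open>r = 0\<close> by (intro exI[of _ "[m]"]) (simp add: odd_iff_mod_2_eq_one)
    next
      case False
      then show ?thesis using nd \<open>r = 0\<close> by (intro exI[of _ "[m - 1, 1]"]) auto
    qed
  next
    case False
    obtain as where as: "as \<noteq> []" "length as mod 2 = (k + 1) mod 2" "\<forall>a\<in>set (tl as). a \<ge> 1"
      "cf_value as = of_int (int d) / of_int (int r)"
      using less.IH[of r "k + 1" "int d"] r(2) False by auto
    have v: "cf_value as > 1" using as(4) r(2) False by simp
    have "hd as \<ge> 1"
    proof (cases "tl as = []")
      case True
      then have "as = [hd as]" using as(1) by (metis list.collapse)
      then have "cf_value as = of_int (hd as)" by (metis cf_value.simps(2))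
      then show ?thesis using v by simp
    next
      case False
      have "cf_value (tl as) \<ge> 1" using cf_value_ge_1 False as(3) by blast
      then have "1 / cf_value (tl as) \<le> 1" by simp
      moreover have "cf_value as = of_int (hd as) + 1 / cf_value (tl as)"
        using cf_value_Cons[OF False, of "hd as"] as(1) by simp
      ultimately have "(of_int (hd as) :: rat) > 0" using v by linarith
      then show ?thesis by simp
    qed
    then have "\<forall>a\<in>set as. a \<ge> 1" using as(1,3) by (cases as) auto
    moreover have "length (m # as) mod 2 = k mod 2" using as(2) by simp presburger
    moreover have "cf_value (m # as) = of_int n / of_int (int d)"
      using as(1,4) nd by (simp add: cf_value_Cons)
    ultimately show ?thesis by (intro exI[of _ "m # as"]) simp
  qed
qed

lemma ex1_even_cf: "\<exists>!as. is_even_cf x as"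
proof -
  obtain n d where nd: "quotient_of x = (n, d)" by force
  have "d > 0" and x: "x = of_int n / of_int d"
    using nd quotient_of_denom_pos quotient_of_div by blast+
  then obtain as where "is_even_cf x as"
    using cf_exists[of "nat d" 0 n] by (auto simp: is_even_cf_def)
  moreover have "as = bs" if "is_even_cf x as" "is_even_cf x bs" for as bs
    using that cf_unique[of as bs] by (auto simp: is_even_cf_def even_iff_mod_2_eq_zero)
  ultimately show ?thesis by blast
qed

lemma eval_a_mult: "eval_a \<alpha> (p * r) = eval_a \<alpha> p * eval_a \<alpha> r"
proof -
  have h: "to_ac (emb 0) = (0 :: qfield alg_closure)"
    "\<And>c d. to_ac (emb (c + d)) = (to_ac (emb c) + to_ac (emb d) :: qfield alg_closure)"
    "\<And>c d. to_ac (emb (c * d)) = (to_ac (emb c) * to_ac (emb d) :: qfield alg_closure)"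
    by (simp_all add: emb_def fract_collapse flip: to_ac_add to_ac_mult)
  have add: "map_poly (\<lambda>c. to_ac (emb c)) (u + v) =
      map_poly (\<lambda>c. to_ac (emb c) :: qfield alg_closure) u + map_poly (\<lambda>c. to_ac (emb c)) v" for u v
    by (rule poly_eqI) (simp add: coeff_map_poly h)
  have smult: "map_poly (\<lambda>c. to_ac (emb c)) (smult e v) =
      smult (to_ac (emb e) :: qfield alg_closure) (map_poly (\<lambda>c. to_ac (emb c)) v)" for e v
    by (rule poly_eqI) (simp add: coeff_map_poly h)
  show ?thesis
    by (induction p) (simp_all add: eval_a_def map_poly_pCons h add smult algebra_simps)
qed

lemma specialize_eq:
  assumes "eval_a \<alpha> d \<noteq> 0"
  shows "specialize \<alpha> (emb p / emb d) = eval_a \<alpha> p / eval_a \<alpha> d"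
  unfolding specialize_def
proof (rule the_equality)
  fix y assume "\<exists>p' d'. emb p / emb d = emb p' / emb d' \<and> eval_a \<alpha> d' \<noteq> 0 \<and>
    y = eval_a \<alpha> p' / eval_a \<alpha> d'"
  then obtain p' d' where *: "emb p / emb d = emb p' / emb d'" "eval_a \<alpha> d' \<noteq> 0"
    "y = eval_a \<alpha> p' / eval_a \<alpha> d'" by blast
  have "d \<noteq> 0" "d' \<noteq> 0" using assms *(2) by (auto simp: eval_a_def)
  then have "p * d' = p' * d" using *(1) by (simp add: emb_def eq_fract)
  then have "eval_a \<alpha> p * eval_a \<alpha> d' = eval_a \<alpha> p' * eval_a \<alpha> d" by (metis eval_a_mult)
  then show "y = eval_a \<alpha> p / eval_a \<alpha> d" unfolding *(3) using assms *(2) by (simp add: frac_eq_eq)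
qed (use assms in blast)

end

theory Submission
  imports Defs
begin

text \<open>The stabilized unknot is a circle with one negative curl, so its polynomial is
  $q^{-1} a \mu = (a^2 - 1)/(q^2 - 1)$. At $a = q \nu_x \delta_x$ we have $a^2 = q^2 \delta_x$,
  and then $(q^2 \delta_x - 1)/(q^2 - 1) = \{x\}$ is equivalent to the shift formula
  $\{x\} = q^2 \{x - 1\} + 1$. The latter is inherited from $\{a_1\} = q^2 \{a_1 - 1\} + 1$, since
  the expansions of $x$ and $x - 1$ differ only in $a_1$.\<close>

lemma emb_mult: "emb (p * r) = emb p * emb r"
  by (simp add: emb_def)

lemma emb_diff: "emb (p - r) = emb p - emb r"
  by (simp add: emb_def)

lemma emb_1: "emb 1 = 1"
  by (simp add: emb_def One_fract_def)

lemma emb_eq_0_iff: "emb p = 0 \<longleftrightarrow> p = 0"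
  by (simp add: emb_def Zero_fract_def eq_fract)

lemma q_nonzero: "q \<noteq> 0"
  by (simp add: q_def emb_eq_0_iff)

text \<open>With an explicit polynomial, \<open>q^2 - 1\<close> is seen to be nonzero by injectivity
  of \<open>emb\<close>.\<close>

lemma emb_q_square_minus_1: "emb [:-1, 0, 1:] = q\<^sup>2 - 1"
proof -
  have "[:-1, 0, 1:] = [:0, 1:] * [:0, 1:] - (1 :: int poly)"
    by (simp add: one_pCons)
  then show ?thesis
    by (simp only: emb_mult emb_diff emb_1 q_def power2_eq_square)
qed

lemma q_square_neq_1: "q\<^sup>2 - 1 \<noteq> 0"
  by (simp add: emb_eq_0_iff flip: emb_q_square_minus_1)

text \<open>Over the common denominator q^2 - 1 this is q^(2a) - 1 = q^2 (q^(2a-2) - 1) + (q^2 -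
  1).\<close>

lemma qint_shift: "qint a = q\<^sup>2 * qint (a - 1) + 1"
proof -
  have "q\<^sup>2 * q powi (2 * (a - 1)) = q powi (2 * a)"
    using q_nonzero by (simp add: power_int_diff right_diff_distrib)
  then show ?thesis
    using q_square_neq_1 by (simp add: qint_def field_simps)
qed

text \<open>The first entry enters only through \<open>qint a\<close> and the numerator
  \<open>q powi (2 * a)\<close>; the denominator \<open>qcf_neg as\<close> stays fixed, and the
  numerator scales by exactly q^2 under the shift.\<close>

lemma qcf_shift:
  assumes "as \<noteq> []"
  shows "qcf (a # as) = q\<^sup>2 * qcf ((a - 1) # as) + 1"
proof -
  obtain b bs where "as = b # bs"
    using assms by (cases as) auto
  moreover have "q powi (2 * a) = q\<^sup>2 * q powi (2 * (a - 1))"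
    using q_nonzero by (simp add: power_int_diff right_diff_distrib)
  ultimately show ?thesis
    by (simp add: qint_shift[of a] distrib_left)
qed

lemma qrat_eq:
  assumes "is_even_cf x as"
  shows "qrat x = qcf as"
  using assms ex1_even_cf the1_equality unfolding qrat_def by metis

lemma qrat_shift: "qrat x = q\<^sup>2 * qrat (x - 1) + 1"
proof -
  obtain cs where cs: "is_even_cf x cs"
    using ex1_even_cf by blast
  \<comment> \<open>The rule splits lists into empty, singleton and longer ones; even length
    excludes singletons.\<close>
  then obtain a as where eq: "cs = a # as" and ne: "as \<noteq> []"
    unfolding is_even_cf_def by (cases cs rule: remdups_adj.cases) auto
  \<comment> \<open>Only the tail is required to have entries \<ge> 1, so the first entry may be
    lowered freely.\<close>
  have "is_even_cf (x - 1) ((a - 1) # as)"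
    using cs ne unfolding eq is_even_cf_def by (auto simp: cf_value_Cons)
  then have "qrat (x - 1) = qcf ((a - 1) # as)"
    by (rule qrat_eq)
  moreover have "qrat x = qcf (a # as)"
    using qrat_eq[OF cs] eq by simp
  ultimately show ?thesis
    using qcf_shift[OF ne, of a] by simp
qed

text \<open>The shift formula eliminates {x - 1} from q^2 ({x} - {x - 1}), leaving (q^2 - 1) {x} +
  1.\<close>

lemma qrat_eq_qdelta: "qrat x = (q\<^sup>2 * qdelta x - 1) / (q\<^sup>2 - 1)"
proof -
  have "q\<^sup>2 * qrat (x - 1) = qrat x - 1"
    using qrat_shift[of x] by simp
  then show ?thesis
    using q_square_neq_1 by (simp add: qdelta_def eq_divide_eq algebra_simps)
qed

lemma homfly_circle:
  assumes "is_framed_homfly P"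
  shows "P [(0, Cup d), (0, Cap)] = mu"
proof -
  have "link_diagram []" "link_diagram [(0, Cup d), (0, Cap)]"
    using slice.cup[of "[]" "[]" d] slice.cap[of "[]" d "[]"]
    by (auto simp: link_diagram_def intro!: tangle.intros)
  moreover have circle: "link_diagram (A @ B) \<Longrightarrow> link_diagram (A @ [(i, Cup d), (i, Cap)] @ B) \<Longrightarrow>
      P (A @ [(i, Cup d), (i, Cap)] @ B) = mu * P (A @ B)" for A B i
    using assms unfolding is_framed_homfly_def by blast
  moreover have "P [] = 1"
    using assms unfolding is_framed_homfly_def by blast
  ultimately show ?thesis
    using circle[of "[]" "[]" 0] by simp
qed

lemma homfly_stabilized_unknot:
  assumes "is_framed_homfly P"
  shows "P stabilized_unknot = inverse vq * va * mu"
proof -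
  have curl: "link_diagram (A @ B) \<Longrightarrow>
      link_diagram (A @ [(i + 1, Cup d), (i, Cross b), (i + 1, Cap)] @ B) \<Longrightarrow>
      P (A @ [(i + 1, Cup d), (i, Cross b), (i + 1, Cap)] @ B) =
        (if b then vq * inverse va else inverse vq * va) * P (A @ B)" for A B i d b
    using assms unfolding is_framed_homfly_def by blast
  have "link_diagram [(0, Cup False), (0, Cap)]"
    using slice.cup[of "[]" "[]" False] slice.cap[of "[]" False "[]"]
    by (auto simp: link_diagram_def intro!: tangle.intros)
  then show ?thesis
    \<comment> \<open>The curl sits between the cup and the cap of a circle, on the right of its
      upward leg, which is strand 1.\<close>
    using curl[of "[(0, Cup False)]" "[(0, Cap)]" 1 True False]
      link_diagram_stabilized_unknot homfly_circle[OF assms, of False]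
    by (simp add: stabilized_unknot_def numeral_2_eq_2)
qed

text \<open>This is the form that \<open>specialize_eq\<close> needs: a^2 - 1 over q^2 - 1, where
  the denominator is constant in a and hence vanishes at no value of a.\<close>

lemma homfly_stabilized_unknot_fraction:
  assumes "is_framed_homfly P"
  shows "P stabilized_unknot = emb [:-1, 0, 1:] / emb [:[:-1, 0, 1:]:]"
proof -
  have "[:-1, 0, 1:] = [:0, 1:] * [:0, 1:] - (1 :: int poly poly)"
    by (simp add: one_pCons)
  then have num: "emb [:-1, 0, 1:] = va\<^sup>2 - 1"
    by (simp only: emb_mult emb_diff emb_1 va_def power2_eq_square)
  have "[:[:-1, 0, 1:]:] = [:[:0, 1:]:] * [:[:0, 1:]:] - (1 :: int poly poly)"
    by (simp add: one_pCons)
  then have den: "emb [:[:-1, 0, 1:]:] = vq\<^sup>2 - 1"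
    by (simp only: emb_mult emb_diff emb_1 vq_def power2_eq_square)
  have nz: "va \<noteq> 0" "vq \<noteq> 0"
    by (simp_all add: va_def vq_def emb_eq_0_iff)
  have "va * (va - inverse va) = va\<^sup>2 - 1" "vq * (vq - inverse vq) = vq\<^sup>2 - 1"
    using nz by (simp_all add: right_diff_distrib power2_eq_square)
  moreover have "inverse vq * va * mu = va * (va - inverse va) / (vq * (vq - inverse vq))"
    by (simp only: mu_def divide_inverse inverse_mult_distrib mult_ac)
  ultimately show ?thesis
    by (simp only: homfly_stabilized_unknot[OF assms] num den)
qed

theorem lemma4p2:
  fixes x :: rat
    and \<nu> :: "qfield alg_closure"
    and P :: "slice list \<Rightarrow> qafield"
  assumes "is_framed_homfly P"
    and "is_qnu x \<nu>"
  shows "homfly_at P x \<nu> stabilized_unknot = to_ac (qrat x)"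
proof -
  define \<alpha> where "\<alpha> = to_ac q * \<nu> * to_ac (qdelta x)"
  have "\<nu>\<^sup>2 = inverse (to_ac (qdelta x))"
    using assms(2) by (simp add: is_qnu_def)
  \<comment> \<open>The factor \<open>\<nu>\<close>^2 cancels one of the two factors
    \<open>qdelta x\<close>; if \<open>qdelta x = 0\<close>, both sides vanish.\<close>
  then have sq: "\<alpha> * \<alpha> = (to_ac q)\<^sup>2 * to_ac (qdelta x)"
    by (cases "qdelta x = 0") (simp_all add: \<alpha>_def power2_eq_square field_simps)
  have emb_simps: "emb (0 :: int poly) = 0" "emb (- 1 :: int poly) = - 1" "emb (1 :: int poly) = 1"
    using emb_diff[of 0 "1 :: int poly"] by (simp_all add: emb_1 emb_eq_0_iff)
  have num: "eval_a \<alpha> [:-1, 0, 1:] = to_ac (q\<^sup>2 * qdelta x - 1)"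
    by (simp add: eval_a_def map_poly_pCons emb_simps sq)
  have den: "eval_a \<alpha> [:[:-1, 0, 1:]:] = to_ac (q\<^sup>2 - 1)"
    by (simp add: eval_a_def map_poly_pCons emb_simps emb_q_square_minus_1)
  have "to_ac (q\<^sup>2 - 1) \<noteq> 0"
    using q_square_neq_1 by (simp only: to_ac_eq_0_iff not_False_eq_True)
  then have "specialize \<alpha> (P stabilized_unknot) = to_ac (q\<^sup>2 * qdelta x - 1) / to_ac (q\<^sup>2 - 1)"
    using specialize_eq[of \<alpha> "[:[:-1, 0, 1:]:]" "[:-1, 0, 1:]"]
    by (simp only: homfly_stabilized_unknot_fraction[OF assms(1)] num den simp_thms)
  also have "\<dots> = to_ac (qrat x)"
    by (simp only: qrat_eq_qdelta to_ac_divide)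
  finally show ?thesis
    by (simp only: homfly_at_def \<alpha>_def)
qed

end
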